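(* Let $\mathcal{A}$ be a finite affine hyperplane arrangement in $\mathbb{R}^\ell$ with a generic flag $\mathcal{F}$ and defining affine forms $h_1,\dots,h_\ell$ satisfying the standing assumptions listed in the context, and let $S(C)\subset\mathbb{C}^\ell$ be the subset attached to each chamber $C\in\mathsf{ch}(\mathcal{A})$ defined in the context. Then the complexified complement $\mathsf{M}(\mathcal{A})$ is the disjoint union of the sets $S(C)$: $$\mathsf{M}(\mathcal{A})=\bigsqcup_{C\in\mathsf{ch}(\mathcal{A})}S(C).$$
   Context: Arrangement: $\mathcal{A}=\{H_1,\dots,H_n\}$ is a finite set of affine hyperplanes in $\mathbb{R}^\ell$. $L(\mathcal{A})$ is the set of nonempty intersections of elements of $\mathcal{A}$ (including $\mathbb{R}^\ell$, the empty intersection). $\mathsf{ch}(\mathcal{A})$ is the set of chambers, i.e. connected components of $\mathbb{R}^\ell\setminus\bigcup_{H\in\mathcal{A}}H$. For an affine subspace $X\subset\mathbb{R}^\ell$, $X_{\mathbb{C}}\subset\mathbb{C}^\ell$ is its complexification, and $\mathsf{M}(\mathcal{A})=\mathbb{C}^\ell\setminus\bigcup_{H\in\mathcal{A}}H_{\mathbb{C}}$. $\tau(X)$ is the linear subspace through the origin parallel to $X$ with $\dim\tau(X)=\dim X$. Flag: $\mathcal{F}:\emptyset=\mathcal{F}^{-1}\subset\mathcal{F}^0\subset\cdots\subset\mathcal{F}^\ell=\mathbb{R}^\ell$ is a generic flag: $\mathcal{F}^q$ is a $q$-dimensional affine subspace with $\dim(\mathcal{F}^q\cap X)=q+\dim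 X-\ell$ for all $X\in L(\mathcal{A})$ (empty intersection when this number is negative). $h_1,\dots,h_\ell$ are affine linear forms on $\mathbb{R}^\ell$ with $\mathcal{F}^q=\{h_{q+1}=\cdots=h_\ell=0\}$ for $0\le q\le\ell-1$. Put $\mathsf{ch}^q_{\mathcal{F}}(\mathcal{A})=\{C\in\mathsf{ch}(\mathcal{A})\mid C\cap\mathcal{F}^q\ne\emptyset,\ C\cap\mathcal{F}^{q-1}=\emptyset\}$. Standing assumption, for $q=1,\dots,\ell$: (1) if $C\in\mathsf{ch}^q_{\mathcal{F}}(\mathcal{A})$ then $C\cap\mathcal{F}^q\subset\{h_{q+1}=\cdots=h_\ell=0,\ h_q>0\}$; (2) if $X\neq X'$ in $L(\mathcal{A})$ both have dimension $\ell-q$ (so each meets $\mathcal{F}^q$ in one point), then $h_q(X\cap\mathcal{F}^q)\ne h_q(X'\cap\mathcal{F}^q)$. The subspace $X_C$: for $C\in\mathsf{ch}^q_{\mathcal{F}}(\mathcal{A})$ with $q\ge1$, $\overline{C}\cap\mathcal{F}^q$ is a $q$-dimensional polyhedron on which $h_q$ attains its minimum at a unique vertex $p$; $X_C$ is the unique element of $L(\mathcal{A})$ with $X_C\cap\mathcal{F}^q=\{p\}$ (so $\dim X_C=\ell-q$). For $q=0$, $X_C=\mathbb{R}^\ell$. For points $p_1,p_2\in\mathbb{R}^\ell$, $\mathrm{Sep}(p_1,p_2)=\{H\in\mathcal{A}\mid[p_1,p_2]\cap H\ne\emptyset\}$, where $[p_1,p_2]$ is the closed line segment. The set $S(C)$: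 for each $q$ and $C\in\mathsf{ch}^q_{\mathcal{F}}(\mathcal{A})$ fix a base point $p_C\in C\cap\mathcal{F}^q$ (the constructions do not depend on the choice), and define $$S(C)=\{x+\sqrt{-1}\,v\in\mathbb{C}^\ell\mid x\in\mathbb{R}^\ell,\ v\in\tau(X_C),\ v\notin\tau(H)\text{ for all }H\in\mathrm{Sep}(p_C,x)\}.$$ *)

theory Defs
  imports "HOL-Analysis.Analysis"
begin

definition hyperplane :: "(real^'n) set \<Rightarrow> bool" where
  "hyperplane H \<longleftrightarrow> (\<exists>a b. a \<noteq> 0 \<and> H = {x. a \<bullet> x = b})"

definition arrangement :: "(real^'n) set set \<Rightarrow> bool" where
  "arrangement A \<longleftrightarrow> finite A \<and> (\<forall>H\<in>A. hyperplane H)"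

(* The empty intersection is the whole space, since Inter {} = UNIV. *)
definition intersection_poset :: "(real^'n) set set \<Rightarrow> (real^'n) set set" where
  "intersection_poset A = {X. X \<noteq> {} \<and> (\<exists>B. B \<subseteq> A \<and> X = \<Inter>B)}"

definition chambers :: "(real^'n) set set \<Rightarrow> (real^'n) set set" where
  "chambers A = components (UNIV - \<Union>A)"

(* Well defined for nonempty affine X, see affine_parallel_subspace. *)
definition direction :: "(real^'n) set \<Rightarrow> (real^'n) set" where
  "direction X = (THE V. subspace V \<and> affine_parallel X V)"

(* The complex solutions of all real affine equations that hold on X. *)
definition complexification :: "(real^'n) set \<Rightarrow> (complex^'n) set" where
  "complexification X =
     {z. \<forall>a b. (\<forall>x\<in>X. a \<bullet> x = b) \<longrightarrow>
            (\<Sum>i\<in>UNIV. complex_of_real (a $ i) * z $ i) = complex_of_real b}"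

definition complexified_complement :: "(real^'n) set set \<Rightarrow> (complex^'n) set" where
  "complexified_complement A = UNIV - (\<Union>H\<in>A. complexification H)"

(* Flags are indexed by the integers -1, ..., CARD('n); values of F at other indices
   are irrelevant.  Note that aff_dim {} = -1. *)
definition generic_flag :: "(real^'n) set set \<Rightarrow> (int \<Rightarrow> (real^'n) set) \<Rightarrow> bool" where
  "generic_flag A F \<longleftrightarrow>
     F (-1) = {} \<and> F (int CARD('n)) = UNIV \<and>
     (\<forall>q\<in>{0..int CARD('n)}.
        F (q - 1) \<subseteq> F q \<and> affine (F q) \<and> aff_dim (F q) = q \<and>
        (\<forall>X\<in>intersection_poset A.
           (if q + aff_dim X - int CARD('n) \<ge> 0
            then aff_dim (F q \<inter> X) = q + aff_dim X - int CARD('n)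
            else F q \<inter> X = {})))"

definition affine_form :: "(real^'n \<Rightarrow> real) \<Rightarrow> bool" where
  "affine_form f \<longleftrightarrow> (\<exists>a b. f = (\<lambda>x. a \<bullet> x + b))"

definition flag_forms ::
  "(int \<Rightarrow> (real^'n) set) \<Rightarrow> (int \<Rightarrow> real^'n \<Rightarrow> real) \<Rightarrow> bool" where
  "flag_forms F h \<longleftrightarrow>
     (\<forall>i\<in>{1..int CARD('n)}. affine_form (h i)) \<and>
     (\<forall>q\<in>{0..int CARD('n) - 1}. F q = {x. \<forall>i\<in>{q+1..int CARD('n)}. h i x = 0})"

definition flag_chambers ::
  "(real^'n) set set \<Rightarrow> (int \<Rightarrow> (real^'n) set) \<Rightarrow> int \<Rightarrow> (real^'n) set set" where
  "flag_chambers A F q = {C \<in> chambers A. C \<inter> F q \<noteq> {} \<and> C \<inter> F (q - 1) = {}}"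

definition standing_assumption ::
  "(real^'n) set set \<Rightarrow> (int \<Rightarrow> (real^'n) set) \<Rightarrow> (int \<Rightarrow> real^'n \<Rightarrow> real) \<Rightarrow> bool" where
  "standing_assumption A F h \<longleftrightarrow>
     (\<forall>q\<in>{1..int CARD('n)}.
        (\<forall>C\<in>flag_chambers A F q.
           C \<inter> F q \<subseteq> {x. (\<forall>i\<in>{q+1..int CARD('n)}. h i x = 0) \<and> h q x > 0}) \<and>
        (\<forall>X\<in>intersection_poset A. \<forall>X'\<in>intersection_poset A.
           X \<noteq> X' \<and> aff_dim X = int CARD('n) - q \<and> aff_dim X' = int CARD('n) - q \<longrightarrow>
           (\<forall>x x'. X \<inter> F q = {x} \<and> X' \<inter> F q = {x'} \<longrightarrow> h q x \<noteq> h q x')))"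

(* The unique q such that C belongs to flag_chambers A F q. *)
definition flag_index ::
  "(real^'n) set set \<Rightarrow> (int \<Rightarrow> (real^'n) set) \<Rightarrow> (real^'n) set \<Rightarrow> int" where
  "flag_index A F C = (THE q. q \<in> {0..int CARD('n)} \<and> C \<in> flag_chambers A F q)"

definition min_vertex ::
  "(int \<Rightarrow> (real^'n) set) \<Rightarrow> (int \<Rightarrow> real^'n \<Rightarrow> real) \<Rightarrow> int \<Rightarrow> (real^'n) set \<Rightarrow> real^'n" where
  "min_vertex F h q C = (THE p. is_arg_min (h q) (\<lambda>x. x \<in> closure C \<inter> F q) p)"

definition chamber_subspace ::
  "(real^'n) set set \<Rightarrow> (int \<Rightarrow> (real^'n) set) \<Rightarrow> (int \<Rightarrow> real^'n \<Rightarrow> real) \<Rightarrow>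
     (real^'n) set \<Rightarrow> (real^'n) set" where
  "chamber_subspace A F h C =
     (let q = flag_index A F C in
      if q = 0 then UNIV
      else (THE X. X \<in> intersection_poset A \<and> X \<inter> F q = {min_vertex F h q C}))"

definition Sep :: "(real^'n) set set \<Rightarrow> real^'n \<Rightarrow> real^'n \<Rightarrow> (real^'n) set set" where
  "Sep A p1 p2 = {H \<in> A. closed_segment p1 p2 \<inter> H \<noteq> {}}"

definition base_points ::
  "(real^'n) set set \<Rightarrow> (int \<Rightarrow> (real^'n) set) \<Rightarrow> ((real^'n) set \<Rightarrow> real^'n) \<Rightarrow> bool" where
  "base_points A F p \<longleftrightarrow>
     (\<forall>q\<in>{0..int CARD('n)}. \<forall>C\<in>flag_chambers A F q. p C \<in> C \<inter> F q)"

definition chamber_stratum ::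
  "(real^'n) set set \<Rightarrow> (int \<Rightarrow> (real^'n) set) \<Rightarrow> (int \<Rightarrow> real^'n \<Rightarrow> real) \<Rightarrow>
     ((real^'n) set \<Rightarrow> real^'n) \<Rightarrow> (real^'n) set \<Rightarrow> (complex^'n) set" where
  "chamber_stratum A F h p C =
     {(\<chi> i. complex_of_real (x $ i) + \<i> * complex_of_real (v $ i)) | x v.
        v \<in> direction (chamber_subspace A F h C) \<and>
        (\<forall>H\<in>Sep A (p C) x. v \<notin> direction H)}"

end

theory Submission
  imports Defs
begin

text \<open>Fix the imaginary part \<open>v\<close> and let \<open>B\<close> consist of the hyperplanes of \<open>A\<close> whose direction contains \<open>v\<close>.
  The points \<open>x\<close> with \<open>x + i v\<close> in the complexified complement are those in the chambers of \<open>B\<close>, and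
  \<open>x + i v\<close> lies in the stratum of \<open>C\<close> iff \<open>v\<close> is parallel to the subspace \<open>X\<close> of \<open>C\<close> and \<open>x\<close> lies in
  the chamber of \<open>B\<close> containing \<open>C\<close>. So each chamber \<open>D\<close> of \<open>B\<close> must contain exactly one chamber \<open>C\<close>
  of \<open>A\<close> whose subspace is parallel to \<open>v\<close>. The subarrangement \<open>B\<close> inherits the hypotheses, so \<open>D\<close>
  has an index \<open>q\<close> and, for \<open>q > 0\<close>, a vertex minimizing \<open>h q\<close> on \<open>closure D \<inter> F q\<close>. All
  hyperplanes of \<open>A\<close> through it are in \<open>B\<close> by genericity, hence exactly one chamber of \<open>A\<close> agrees with
  \<open>D\<close> near it, and this is \<open>C\<close>. Conversely, if \<open>v\<close> is parallel to the subspace of \<open>C \<subseteq> D\<close>, then \<open>C\<close>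
  agrees with \<open>D\<close> near the minimal vertex of \<open>C\<close>, which by convexity is then the minimal vertex of
  \<open>D\<close>.\<close>

subsection \<open>Directions and complexifications\<close>

lemma affine_line_mem:
  assumes "affine S" "x \<in> S" "y \<in> S"
  shows "x + t *\<^sub>R (y - x) \<in> S"
proof -
  have "(1 - t) *\<^sub>R x + t *\<^sub>R y \<in> S"
    using assms unfolding affine_alt by blast
  then show ?thesis
    by (simp add: algebra_simps)
qed

text \<open>Removes the definite description: the unique parallel subspace has the form
  \<open>a + X\<close>, contains \<open>a + x\<close>, and is closed under adding and subtracting
  that vector.\<close>

lemma mem_direction_iff:
  assumes "affine X" "x \<in> X"
  shows "v \<in> direction X \<longleftrightarrow> x + v \<in> X"
proof -
  have V: "subspace (direction X) \<and> affine_parallel X (direction X)"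
    unfolding direction_def
    by (rule theI', rule affine_parallel_subspace) (use assms in auto)
  then obtain a where a: "direction X = (+) a ` X"
    unfolding affine_parallel_def by blast
  have ax: "a + x \<in> direction X"
    using a assms(2) by blast
  have "v \<in> direction X \<longleftrightarrow> a + (x + v) \<in> direction X"
  proof
    assume "v \<in> direction X"
    then have "(a + x) + v \<in> direction X"
      using V ax subspace_add by blast
    then show "a + (x + v) \<in> direction X"
      by (simp add: add.assoc)
  next
    assume "a + (x + v) \<in> direction X"
    then have "(a + (x + v)) - (a + x) \<in> direction X"
      using V ax subspace_diff by blast
    then show "v \<in> direction X"
      by simp
  qed
  also have "\<dots> \<longleftrightarrow> x + v \<in> X"
    by (simp add: a image_iff)
  finally show ?thesis .
qed

lemma direction_UNIV [simp]: "direction UNIV = UNIV"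
  using mem_direction_iff[of UNIV] by auto

lemma hyperplane_affine: "hyperplane H \<Longrightarrow> affine H"
  unfolding hyperplane_def by (auto simp: affine_hyperplane)

lemma hyperplane_closed: "hyperplane H \<Longrightarrow> closed H"
  unfolding hyperplane_def by (auto simp: closed_hyperplane)

text \<open>A real linear form evaluated at \<open>x + i v\<close> has real part
  \<open>a \<bullet> x\<close> and imaginary part \<open>a \<bullet> v\<close>, so one complex
  equation splits into two real ones.\<close>

lemma mem_complexification_hyperplane_iff:
  assumes "hyperplane H"
  shows "(\<chi> i. complex_of_real (x $ i) + \<i> * complex_of_real (v $ i)) \<in> complexification H
    \<longleftrightarrow> x \<in> H \<and> v \<in> direction H"
    (is "?z \<in> _ \<longleftrightarrow> _")
proof -
  have sum_eq: "(\<Sum>i\<in>UNIV. complex_of_real (a $ i) * ?z $ i) = Complex (a \<bullet> x) (a \<bullet> v)" for a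
    by (simp add: complex_eq_iff inner_vec_def)
  obtain a b where H: "H = {x. a \<bullet> x = b}"
    using assms unfolding hyperplane_def by blast
  show ?thesis
  proof
    assume "?z \<in> complexification H"
    then have "Complex (a \<bullet> x) (a \<bullet> v) = complex_of_real b"
      unfolding complexification_def mem_Collect_eq sum_eq by (auto simp: H)
    then have "a \<bullet> x = b" "a \<bullet> v = 0"
      by (auto simp: complex_eq_iff)
    then show "x \<in> H \<and> v \<in> direction H"
      using mem_direction_iff[OF hyperplane_affine[OF assms], of x v]
      by (simp add: H inner_add_right)
  next
    assume xv: "x \<in> H \<and> v \<in> direction H"
    then have xvH: "x + v \<in> H"
      using mem_direction_iff[OF hyperplane_affine[OF assms]] by blast
    \<comment> \<open>Every equation valid on \<open>H\<close> must be tested; comparing its values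
      at \<open>x\<close> and \<open>x + v\<close> gives the homogeneous part.\<close>
    have "a' \<bullet> x = b' \<and> a' \<bullet> v = 0" if "\<forall>y\<in>H. a' \<bullet> y = b'" for a' b'
      using that xv xvH inner_add_right[of a' x v] by force
    then show "?z \<in> complexification H"
      unfolding complexification_def mem_Collect_eq sum_eq by (auto simp: complex_eq_iff)
  qed
qed

lemma mem_complexified_complement_iff:
  assumes "arrangement A"
  shows "(\<chi> i. complex_of_real (x $ i) + \<i> * complex_of_real (v $ i))
      \<in> complexified_complement A \<longleftrightarrow> x \<notin> \<Union>{H \<in> A. v \<in> direction H}"
    (is "?z \<in> _ \<longleftrightarrow> _")
proof -
  have "?z \<in> complexification H \<longleftrightarrow> x \<in> H \<and> v \<in> direction H" if "H \<in> A" for H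
    using assms that mem_complexification_hyperplane_iff unfolding arrangement_def by blast
  then show ?thesis
    unfolding complexified_complement_def by blast
qed

lemma ex_real_imaginary_parts:
  fixes z :: "complex^'n"
  shows "\<exists>x v. z = (\<chi> i. complex_of_real (x $ i) + \<i> * complex_of_real (v $ i))"
  by (intro exI[of _ "\<chi> i. Re (z $ i)"] exI[of _ "\<chi> i. Im (z $ i)"])
    (simp add: vec_eq_iff complex_eq_iff)

lemma real_imaginary_parts_eq_iff:
  "(\<chi> i. complex_of_real (x $ i) + \<i> * complex_of_real (v $ i)) =
   (\<chi> i. complex_of_real (y $ i) + \<i> * complex_of_real (w $ i)) \<longleftrightarrow> x = y \<and> v = w"
  by (auto simp: vec_eq_iff complex_eq_iff)

subsection \<open>Chambers\<close>

lemma arrangement_subset: "arrangement A \<Longrightarrow> B \<subseteq> A \<Longrightarrow> arrangement B"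
  unfolding arrangement_def using finite_subset by blast

lemma intersection_poset_mono: "B \<subseteq> A \<Longrightarrow> intersection_poset B \<subseteq> intersection_poset A"
  unfolding intersection_poset_def by blast

text \<open>By connectedness \<open>C\<close> stays on one side of each hyperplane, and the normals
  are signed so that this is the \<open><\<close> side. The cell so described is convex, so
  maximality of components makes it \<open>C\<close>.\<close>

lemma chamber_halfspaces:
  assumes "arrangement A" "C \<in> chambers A"
  shows "\<exists>a b. (\<forall>H\<in>A. H = {x. a H \<bullet> x = b H}) \<and> C = {x. \<forall>H\<in>A. a H \<bullet> x < b H}
    \<and> closure C = {x. \<forall>H\<in>A. a H \<bullet> x \<le> b H}"
proof -
  have C: "C \<noteq> {}" "connected C" "C \<subseteq> UNIV - \<Union>A"
    using assms(2) unfolding chambers_def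
    by (auto simp: in_components_connected dest: in_components_nonempty in_components_subset)
  obtain d where d: "d \<in> C"
    using C(1) by blast
  have "\<exists>a b. H = {x. a \<bullet> x = b} \<and> C \<subseteq> {x. a \<bullet> x < b}" if H: "H \<in> A" for H
  proof -
    obtain a b where ab: "H = {x. a \<bullet> x = b}"
      using assms(1) H unfolding arrangement_def hyperplane_def by blast
    have ne: "a \<bullet> x \<noteq> b" if "x \<in> C" for x
      using C(3) that H ab by auto
    have "C \<subseteq> {x. a \<bullet> x < b} \<or> C \<subseteq> {x. a \<bullet> x > b}"
    proof (rule ccontr)
      assume "\<not> ?thesis"
      then obtain x y where "x \<in> C" "y \<in> C" "a \<bullet> y \<le> b" "b \<le> a \<bullet> x"
        unfolding subset_eq mem_Collect_eq using leI by metis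
      then obtain z where "z \<in> C" "a \<bullet> z = b"
        using connected_ivt_hyperplane[OF C(2)] by blast
      then show False
        using ne by blast
    qed
    then show ?thesis
    proof
      assume "C \<subseteq> {x. a \<bullet> x < b}"
      then show ?thesis
        using ab by blast
    next
      assume "C \<subseteq> {x. a \<bullet> x > b}"
      then have "H = {x. (- a) \<bullet> x = - b} \<and> C \<subseteq> {x. (- a) \<bullet> x < - b}"
        using ab by auto
      then show ?thesis
        by blast
    qed
  qed
  then obtain a b where ab: "\<And>H. H \<in> A \<Longrightarrow> H = {x. a H \<bullet> x = b H} \<and> C \<subseteq> {x. a H \<bullet> x < b H}"
    by metis
  have C_eq: "C = {x. \<forall>H\<in>A. a H \<bullet> x < b H}" (is "_ = ?D")
  proof
    show "C \<subseteq> ?D"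
      using ab by blast
    have D: "?D = (\<Inter>H\<in>A. {x. a H \<bullet> x < b H})"
      by auto
    have "convex ?D"
      unfolding D by (intro convex_INT convex_halfspace_lt)
    moreover have "?D \<subseteq> UNIV - \<Union>A"
    proof
      fix x assume x: "x \<in> ?D"
      have "x \<notin> H" if "H \<in> A" for H
      proof
        assume "x \<in> H"
        then have "a H \<bullet> x = b H"
          using ab[OF that] by blast
        then show False
          using x that by auto
      qed
      then show "x \<in> UNIV - \<Union>A"
        by blast
    qed
    moreover have "C \<inter> ?D \<noteq> {}"
      using d \<open>C \<subseteq> ?D\<close> by blast
    ultimately show "?D \<subseteq> C"
      using components_maximal[of C "UNIV - \<Union>A" ?D] assms(2) convex_connected
      unfolding chambers_def by blast
  qed
  have "closure C = {x. \<forall>H\<in>A. a H \<bullet> x \<le> b H}" (is "_ = ?E")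
  proof
    have E: "?E = (\<Inter>H\<in>A. {x. a H \<bullet> x \<le> b H})"
      by auto
    have "closed ?E"
      unfolding E by (intro closed_INT ballI closed_halfspace_le)
    moreover have "C \<subseteq> ?E"
      unfolding C_eq by (auto intro: less_imp_le)
    ultimately show "closure C \<subseteq> ?E"
      by (rule closure_minimal[rotated])
    show "?E \<subseteq> closure C"
    proof
      fix x assume x: "x \<in> ?E"
      \<comment> \<open>Mixing a strict inequality at \<open>d\<close> with a weak one at
        \<open>x\<close> stays strict, so \<open>x\<close> is a limit of points of \<open>C\<close>
        on the segment towards \<open>d\<close>.\<close>
      have "x + t *\<^sub>R (d - x) \<in> C" if t: "0 < t" "t \<le> 1" for t :: real
      proof -
        have "a H \<bullet> (x + t *\<^sub>R (d - x)) < b H" if H: "H \<in> A" for H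
        proof -
          have "a H \<bullet> x \<le> b H" "a H \<bullet> d < b H"
            using x H d C_eq by auto
          then have "(1 - t) * (a H \<bullet> x) \<le> (1 - t) * b H" "t * (a H \<bullet> d) < t * b H"
            using t by (auto intro: mult_left_mono mult_strict_left_mono)
          then show ?thesis
            by (simp add: algebra_simps)
        qed
        then show ?thesis
          unfolding C_eq by blast
      qed
      then have "\<forall>\<^sub>F t in at_right 0. x + t *\<^sub>R (d - x) \<in> closure C"
        using closure_subset[of C]
        by (intro eventually_at_rightI[of 0 1]) auto
      moreover have "((\<lambda>t. x + t *\<^sub>R (d - x)) \<longlongrightarrow> x + 0 *\<^sub>R (d - x)) (at_right 0)"
        by (intro tendsto_intros)
      ultimately have "x + 0 *\<^sub>R (d - x) \<in> closure C"
        by (intro Lim_in_closed_set[OF closed_closure _ trivial_limit_at_right_real])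
      then show "x \<in> closure C"
        by simp
    qed
  qed
  then show ?thesis
    using ab C_eq by blast
qed

lemma chamber_convex:
  assumes "arrangement A" "C \<in> chambers A"
  shows "convex C"
proof -
  obtain a b where C: "C = {x. \<forall>H\<in>A. a H \<bullet> x < b H}"
    using chamber_halfspaces[OF assms] by blast
  have "C = (\<Inter>H\<in>A. {x. a H \<bullet> x < b H})"
    unfolding C by auto
  then show ?thesis
    by (simp add: convex_INT convex_halfspace_lt)
qed

lemma chamber_open:
  assumes "arrangement A" "C \<in> chambers A"
  shows "open C"
proof -
  obtain a b where C: "C = {x. \<forall>H\<in>A. a H \<bullet> x < b H}"
    using chamber_halfspaces[OF assms] by blast
  have "C = (\<Inter>H\<in>A. {x. a H \<bullet> x < b H})"
    unfolding C by auto
  moreover have "finite A"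
    using assms(1) unfolding arrangement_def by blast
  ultimately show ?thesis
    by (simp add: open_INT open_halfspace_lt)
qed

lemma chamber_nonempty: "C \<in> chambers A \<Longrightarrow> C \<noteq> {}"
  unfolding chambers_def by (rule in_components_nonempty)

lemma chamber_disjoint_Union: "C \<in> chambers A \<Longrightarrow> C \<inter> \<Union>A = {}"
  unfolding chambers_def using in_components_subset by blast

lemma ex_chamber:
  assumes "x \<notin> \<Union>A"
  shows "\<exists>C\<in>chambers A. x \<in> C"
  using assms Union_components[of "UNIV - \<Union>A"] unfolding chambers_def by blast

lemma chamber_eqI:
  "C \<in> chambers A \<Longrightarrow> C' \<in> chambers A \<Longrightarrow> x \<in> C \<Longrightarrow> x \<in> C' \<Longrightarrow> C = C'"
  unfolding chambers_def using components_eq by blast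

lemma connected_subset_chamber:
  assumes "C \<in> chambers A" "connected T" "T \<inter> \<Union>A = {}" "x \<in> C" "x \<in> T"
  shows "T \<subseteq> C"
  using assms components_maximal[of C "UNIV - \<Union>A" T] unfolding chambers_def by blast

lemma chamber_subset_chamber:
  assumes "B \<subseteq> A" "C \<in> chambers A" "D \<in> chambers B" "x \<in> C" "x \<in> D"
  shows "C \<subseteq> D"
proof (rule connected_subset_chamber[OF assms(3) _ _ assms(5,4)])
  show "connected C"
    using assms(2) unfolding chambers_def by (rule in_components_connected)
  show "C \<inter> \<Union>B = {}"
    using chamber_disjoint_Union[OF assms(2)] assms(1) by blast
qed

text \<open>Chambers are convex and segments are connected. This turns the condition on
  \<open>Sep\<close> into membership in a chamber.\<close>

lemma mem_chamber_iff_segment: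
  assumes "arrangement A" "C \<in> chambers A" "x \<in> C"
  shows "y \<in> C \<longleftrightarrow> closed_segment x y \<inter> \<Union>A = {}"
proof
  assume "y \<in> C"
  then have "closed_segment x y \<subseteq> C"
    by (rule closed_segment_subset[OF assms(3) _ chamber_convex[OF assms(1,2)]])
  then show "closed_segment x y \<inter> \<Union>A = {}"
    using chamber_disjoint_Union[OF assms(2)] by blast
next
  assume "closed_segment x y \<inter> \<Union>A = {}"
  then show "y \<in> C"
    using connected_subset_chamber[OF assms(2) connected_segment(1) _ assms(3), of x y] by auto
qed

section \<open>Behaviour of chambers near a point\<close>

lemma no_new_hyperplane_near:
  assumes "arrangement A"
  obtains e where "e > 0" "\<And>H. H \<in> A \<Longrightarrow> H \<inter> ball p e \<noteq> {} \<Longrightarrow> p \<in> H"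
proof -
  have "closed (\<Union>{H \<in> A. p \<notin> H})"
    using assms hyperplane_closed unfolding arrangement_def by (intro closed_Union) auto
  then have "open (- \<Union>{H \<in> A. p \<notin> H})" "p \<in> - \<Union>{H \<in> A. p \<notin> H}"
    by auto
  then obtain e where "e > 0" "ball p e \<subseteq> - \<Union>{H \<in> A. p \<notin> H}"
    by (rule openE)
  then show thesis
    using that by blast
qed

text \<open>Close to \<open>p\<close> only hyperplanes through \<open>p\<close> are met; these lie
  in \<open>B\<close>, so \<open>D\<close> avoids them. A small convex piece of \<open>D\<close>
  therefore lies in one chamber of \<open>A\<close>.\<close>

lemma chambers_agree_near:
  assumes A: "arrangement A" "B \<subseteq> A"
    and C: "C \<in> chambers A" "D \<in> chambers B" "C \<subseteq> D" "p \<in> closure C"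
    and B: "\<And>H. H \<in> A \<Longrightarrow> p \<in> H \<Longrightarrow> H \<in> B"
  obtains e where "e > 0" "ball p e \<inter> D \<subseteq> C"
proof -
  obtain e where e: "e > 0" "\<And>H. H \<in> A \<Longrightarrow> H \<inter> ball p e \<noteq> {} \<Longrightarrow> p \<in> H"
    using no_new_hyperplane_near[OF A(1)] by blast
  obtain x where x: "x \<in> C" "x \<in> ball p e"
    using C(4) e(1) unfolding closure_approachable by (auto simp: dist_commute)
  have "ball p e \<inter> D \<inter> \<Union>A = {}"
    using e(2) B chamber_disjoint_Union[OF C(2)] by blast
  moreover have "connected (ball p e \<inter> D)"
    by (intro convex_connected convex_Int convex_ball
        chamber_convex[OF arrangement_subset[OF A] C(2)])
  ultimately have "ball p e \<inter> D \<subseteq> C"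
    using connected_subset_chamber[OF C(1)] x C(3) by blast
  then show thesis
    using that e(1) by blast
qed

text \<open>The open set \<open>C\<close> is its own relative interior and meets \<open>S\<close>,
  which lets closure commute with the intersection.\<close>

lemma closure_chamber_Int_affine:
  assumes "arrangement A" "C \<in> chambers A" "affine S" "C \<inter> S \<noteq> {}"
  shows "closure (C \<inter> S) = closure C \<inter> S"
  using assms rel_interior_open[OF chamber_open[OF assms(1,2)]]
  by (intro convex_affine_closure_Int chamber_convex) auto

text \<open>Hyperplanes through \<open>p\<close> contain the whole line in direction
  \<open>u\<close>, so their inequalities remain equalities; the others are strict at
  \<open>p\<close> and survive a short move by continuity.\<close>

lemma closure_chamber_extend:
  assumes "arrangement A" "C \<in> chambers A" "p \<in> closure C"
    and u: "\<And>H. H \<in> A \<Longrightarrow> p \<in> H \<Longrightarrow> p + u \<in> H"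
  obtains e where "e > 0" "p + e *\<^sub>R u \<in> closure C"
proof -
  obtain a b where H: "\<And>H. H \<in> A \<Longrightarrow> H = {x. a H \<bullet> x = b H}"
    and cl: "closure C = {x. \<forall>H\<in>A. a H \<bullet> x \<le> b H}"
    using chamber_halfspaces[OF assms(1,2)] by blast
  have "\<forall>\<^sub>F t in at_right 0. a K \<bullet> (p + t *\<^sub>R u) \<le> b K" if K: "K \<in> A" for K
  proof (cases "p \<in> K")
    case True
    then have "a K \<bullet> p = b K" "a K \<bullet> (p + u) = b K"
      using u[OF K] H[OF K] by auto
    then show ?thesis
      by (simp add: inner_add_right)
  next
    case False
    then have "a K \<bullet> p < b K"
      using H[OF K] K assms(3) cl by fastforce
    moreover have "((\<lambda>t. a K \<bullet> (p + t *\<^sub>R u)) \<longlongrightarrow> a K \<bullet> (p + 0 *\<^sub>R u)) (at_right 0)"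
      by (intro tendsto_intros)
    ultimately have "\<forall>\<^sub>F t in at_right 0. a K \<bullet> (p + t *\<^sub>R u) < b K"
      by (auto dest: order_tendstoD)
    then show ?thesis
      by (rule eventually_mono) simp
  qed
  moreover have "finite A"
    using assms(1) unfolding arrangement_def by blast
  ultimately have "\<forall>\<^sub>F t in at_right 0. \<forall>K\<in>A. a K \<bullet> (p + t *\<^sub>R u) \<le> b K"
    by (intro eventually_ball_finite) auto
  then have "\<forall>\<^sub>F t in at_right 0. 0 < t \<and> p + t *\<^sub>R u \<in> closure C"
    unfolding cl using eventually_at_right_less[of "0::real"] by eventually_elim simp
  then have "\<exists>t>0. p + t *\<^sub>R u \<in> closure C"
    using eventually_happens'[OF trivial_limit_at_right_real] by blast
  then show thesis
    using that by blast
qed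

lemma ex_point_off_hyperplanes:
  assumes "arrangement A" "affine S" "d \<in> S" "open U" "d \<in> U"
    and "\<And>H. H \<in> A \<Longrightarrow> \<not> S \<subseteq> H"
  shows "\<exists>x\<in>S \<inter> U. x \<notin> \<Union>A"
proof -
  have "finite A"
    using assms(1) unfolding arrangement_def by blast
  then show ?thesis
    using assms
  proof (induction A)
    case empty
    then show ?case by auto
  next
    case (insert H A)
    then obtain x where x: "x \<in> S" "x \<in> U" "x \<notin> \<Union>A"
      using arrangement_subset[of "insert H A" A] by (metis IntE insertCI subset_insertI)
    obtain z where z: "z \<in> S" "z \<notin> H"
      using insert.prems(6) by blast
    have H: "hyperplane H" and cl: "closed (\<Union>A)"
      using insert.prems(1) insert.hyps hyperplane_closed unfolding arrangement_def by auto
    show ?case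
    proof (cases "x \<in> H")
      case False
      then show ?thesis using x by auto
    next
      case True
      \<comment> \<open>A short move towards \<open>z\<close> stays in \<open>U\<close> and off the
        earlier hyperplanes, and it leaves \<open>H\<close>, since otherwise the line through
        \<open>x\<close> and \<open>z\<close> would lie in \<open>H\<close>.\<close>
      have "((\<lambda>t. x + t *\<^sub>R (z - x)) \<longlongrightarrow> x + 0 *\<^sub>R (z - x)) (at_right 0)"
        by (intro tendsto_intros)
      then have "\<forall>\<^sub>F t in at_right 0. x + t *\<^sub>R (z - x) \<in> U - \<Union>A"
        using topological_tendstoD[of _ _ "at_right 0" "U - \<Union>A"] x cl insert.prems(4)
        by (auto simp: open_Diff)
      then have "\<forall>\<^sub>F t in at_right 0. (0::real) < t \<and> x + t *\<^sub>R (z - x) \<in> U - \<Union>A"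
        using eventually_at_right_less[of "0::real"] by eventually_elim simp
      then obtain t :: real where t: "t > 0" "x + t *\<^sub>R (z - x) \<in> U - \<Union>A"
        using eventually_happens'[OF trivial_limit_at_right_real] by blast
      have "x + t *\<^sub>R (z - x) \<notin> H"
      proof
        assume "x + t *\<^sub>R (z - x) \<in> H"
        then have "x + (1 / t) *\<^sub>R ((x + t *\<^sub>R (z - x)) - x) \<in> H"
          using True affine_line_mem[OF hyperplane_affine[OF H]] by blast
        then show False
          using t z by simp
      qed
      moreover have "x + t *\<^sub>R (z - x) \<in> S"
        using affine_line_mem[OF insert.prems(2)] x z by blast
      ultimately show ?thesis
        using t by blast
    qed
  qed
qed

subsection \<open>Arrangements with a generic flag\<close>

text \<open>Bundles the hypotheses on arrangement, flag and forms so that the facts below can be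
  reused for a subarrangement.\<close>

locale flagged_arrangement =
  fixes A :: "(real^'n) set set"
    and F :: "int \<Rightarrow> (real^'n) set"
    and h :: "int \<Rightarrow> real^'n \<Rightarrow> real"
  assumes arrangement: "arrangement A"
    and flag: "generic_flag A F"
    and forms: "flag_forms F h"
    and standing: "standing_assumption A F h"
begin

lemma F_minus1: "F (- 1) = {}" and F_top: "F (int CARD('n)) = UNIV"
  using flag unfolding generic_flag_def by auto

lemma
  assumes "q \<in> {0..int CARD('n)}"
  shows F_Suc: "F (q - 1) \<subseteq> F q" and F_affine: "affine (F q)" and F_dim: "aff_dim (F q) = q"
  using flag assms unfolding generic_flag_def by auto

text \<open>Since \<open>aff_dim {}\<close> is -1, an intersection of nonnegative dimension is
  nonempty.\<close>

lemma F_generic: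
  assumes "q \<in> {0..int CARD('n)}" "X \<in> intersection_poset A"
  shows "F q \<inter> X \<noteq> {} \<longleftrightarrow> int CARD('n) - q \<le> aff_dim X"
    and "F q \<inter> X \<noteq> {} \<Longrightarrow> aff_dim (F q \<inter> X) = q + aff_dim X - int CARD('n)"
proof -
  have *: "if q + aff_dim X - int CARD('n) \<ge> 0
    then aff_dim (F q \<inter> X) = q + aff_dim X - int CARD('n) else F q \<inter> X = {}"
    using flag assms unfolding generic_flag_def by blast
  then show "F q \<inter> X \<noteq> {} \<Longrightarrow> aff_dim (F q \<inter> X) = q + aff_dim X - int CARD('n)"
    by (auto split: if_splits)
  show "F q \<inter> X \<noteq> {} \<longleftrightarrow> int CARD('n) - q \<le> aff_dim X"
    using * aff_dim_empty[of "F q \<inter> X"] by (auto split: if_splits)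
qed

lemma F_mono:
  assumes "- 1 \<le> i" "i \<le> j" "j \<le> int CARD('n)"
  shows "F i \<subseteq> F j"
  using assms(2,3)
proof (induction j rule: int_ge_induct)
  case base
  then show ?case by simp
next
  case (step j)
  then show ?case
    using F_Suc[of "j + 1"] assms(1) by auto
qed

lemma F_nonempty: "q \<in> {0..int CARD('n)} \<Longrightarrow> F q \<noteq> {}"
  using F_dim[of q] aff_dim_empty[of "F q"] by force

lemma F_zero_sing: "\<exists>c. F 0 = {c}"
  using F_dim[of 0] aff_dim_eq_0[of "F 0"] by simp

lemma F_eq:
  assumes "q \<in> {0..int CARD('n) - 1}"
  shows "F q = {x. \<forall>i\<in>{q+1..int CARD('n)}. h i x = 0}"
  using forms assms unfolding flag_forms_def by blast

lemma form_zero: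
  assumes "q \<in> {1..int CARD('n)}" "x \<in> F q"
  shows "\<forall>i\<in>{q+1..int CARD('n)}. h i x = 0"
\<comment> \<open>\<open>F_eq\<close> stops below the top index; there the range of forms is
  empty.\<close>
proof (cases "q = int CARD('n)")
  case False
  then show ?thesis
    using F_eq[of q] assms by auto
qed auto

lemma mem_F_pred_iff:
  assumes "q \<in> {1..int CARD('n)}" "x \<in> F q"
  shows "x \<in> F (q - 1) \<longleftrightarrow> h q x = 0"
proof -
  have "{q..int CARD('n)} = insert q {q+1..int CARD('n)}"
    using assms(1) by auto
  then show ?thesis
    using F_eq[of "q - 1"] form_zero[OF assms] assms(1) by auto
qed

lemma form_line:
  assumes "q \<in> {1..int CARD('n)}"
  shows "h q (x + t *\<^sub>R (y - x)) = h q x + t * (h q y - h q x)"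
proof -
  have "affine_form (h q)"
    using forms assms unfolding flag_forms_def by blast
  then obtain a b where "h q = (\<lambda>x. a \<bullet> x + b)"
    unfolding affine_form_def by blast
  then show ?thesis
    by (simp add: inner_add_right inner_diff_right algebra_simps)
qed

lemma form_continuous:
  assumes "q \<in> {1..int CARD('n)}"
  shows "continuous_on S (h q)"
proof -
  have "affine_form (h q)"
    using forms assms unfolding flag_forms_def by blast
  then obtain a b where "h q = (\<lambda>x. a \<bullet> x + b)"
    unfolding affine_form_def by blast
  then show ?thesis
    by (auto intro!: continuous_intros)
qed

lemma form_pos:
  assumes "q \<in> {1..int CARD('n)}" "C \<in> flag_chambers A F q" "x \<in> C" "x \<in> F q"
  shows "0 < h q x"
  using bspec[OF conjunct1[OF bspec[OF standing[unfolded standing_assumption_def] assms(1)]] assms(2)]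
    assms(3,4) by blast

lemma poset_Int_form_neq:
  assumes "q \<in> {1..int CARD('n)}" "X \<in> intersection_poset A" "X' \<in> intersection_poset A"
    and "X \<noteq> X'" "aff_dim X = int CARD('n) - q" "aff_dim X' = int CARD('n) - q"
    and "X \<inter> F q = {x}" "X' \<inter> F q = {x'}"
  shows "h q x \<noteq> h q x'"
  using conjunct2[OF bspec[OF standing[unfolded standing_assumption_def] assms(1)],
      rule_format, OF assms(2,3), of x x'] assms(4-) by blast

section \<open>Hyperplanes, flats and vertices\<close>

lemma hyperplane_mem: "H \<in> A \<Longrightarrow> hyperplane H"
  using arrangement unfolding arrangement_def by blast

lemma hyperplane_in_poset: "H \<in> A \<Longrightarrow> H \<in> intersection_poset A"
proof -
  assume "H \<in> A"
  moreover from this have "H \<noteq> {}"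
    using hyperplane_mem unfolding hyperplane_def using hyperplane_eq_empty by blast
  ultimately show ?thesis
    unfolding intersection_poset_def by (auto intro!: exI[of _ "{H}"])
qed

text \<open>Containment would give the intersection dimension \<open>q\<close>, while genericity
  makes it \<open>q - 1\<close>.\<close>

lemma F_not_subset_hyperplane:
  assumes "q \<in> {0..int CARD('n)}" "H \<in> A"
  shows "\<not> F q \<subseteq> H"
proof
  assume "F q \<subseteq> H"
  then have Int: "F q \<inter> H = F q"
    by blast
  have "aff_dim H = int CARD('n) - 1"
    using hyperplane_mem[OF assms(2)] aff_dim_hyperplane unfolding hyperplane_def by force
  then have "aff_dim (F q \<inter> H) = q - 1"
    using F_generic(2)[OF assms(1) hyperplane_in_poset[OF assms(2)]] F_nonempty[OF assms(1)] Int
    by simp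
  then show False
    using F_dim[OF assms(1)] Int by simp
qed

text \<open>The least element of the intersection poset containing \<open>x\<close>; the whole space
  if no hyperplane passes through \<open>x\<close>.\<close>

definition flat :: "real^'n \<Rightarrow> (real^'n) set" where
  "flat x = \<Inter>{H \<in> A. x \<in> H}"

lemma mem_flat: "x \<in> flat x"
  unfolding flat_def by blast

lemma flat_in_poset: "flat x \<in> intersection_poset A"
  unfolding intersection_poset_def using mem_flat unfolding flat_def by blast

lemma poset_affine: "X \<in> intersection_poset A \<Longrightarrow> affine X"
  unfolding intersection_poset_def using hyperplane_mem hyperplane_affine
  by (auto intro!: affine_Inter)

lemma flat_affine: "affine (flat x)"
  using flat_in_poset poset_affine by blast

lemma flat_subset: "X \<in> intersection_poset A \<Longrightarrow> x \<in> X \<Longrightarrow> flat x \<subseteq> X"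
  unfolding intersection_poset_def flat_def by blast

lemma finite_poset: "finite (intersection_poset A)"
proof -
  have "finite A"
    using arrangement unfolding arrangement_def by blast
  moreover have "intersection_poset A \<subseteq> Inter ` Pow A"
    unfolding intersection_poset_def by blast
  ultimately show ?thesis
    using finite_subset by blast
qed

text \<open>With \<open>B\<close> the set of hyperplanes whose direction contains \<open>v\<close>,
  the right-hand side says that all hyperplanes of \<open>A\<close> through \<open>x\<close> belong
  to \<open>B\<close>.\<close>

lemma mem_direction_flat_iff:
  "v \<in> direction (flat x) \<longleftrightarrow> (\<forall>H\<in>A. x \<in> H \<longrightarrow> v \<in> direction H)"
proof -
  have "v \<in> direction (flat x) \<longleftrightarrow> x + v \<in> flat x"
    by (rule mem_direction_iff[OF flat_affine mem_flat])
  also have "\<dots> \<longleftrightarrow> (\<forall>H\<in>A. x \<in> H \<longrightarrow> x + v \<in> H)"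
    unfolding flat_def by blast
  also have "\<dots> \<longleftrightarrow> (\<forall>H\<in>A. x \<in> H \<longrightarrow> v \<in> direction H)"
    using mem_direction_iff[OF hyperplane_affine[OF hyperplane_mem]] by blast
  finally show ?thesis .
qed

text \<open>A vertex is a point of \<open>F q\<close> cut out by the hyperplanes through it; by genericity this is a
  condition on the dimension of its flat.\<close>
definition is_vertex :: "int \<Rightarrow> real^'n \<Rightarrow> bool" where
  "is_vertex q x \<longleftrightarrow> x \<in> F q \<and> aff_dim (flat x) = int CARD('n) - q"

lemma vertex_Int:
  assumes "q \<in> {0..int CARD('n)}" "is_vertex q x"
  shows "flat x \<inter> F q = {x}"
proof -
  have x: "x \<in> F q \<inter> flat x"
    using assms mem_flat unfolding is_vertex_def by blast
  then have "aff_dim (F q \<inter> flat x) = 0"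
    using F_generic(2)[OF assms(1) flat_in_poset] assms(2) unfolding is_vertex_def by fastforce
  then obtain a where "F q \<inter> flat x = {a}"
    unfolding aff_dim_eq_0 by blast
  then show ?thesis
    using x by (metis Int_commute singletonD)
qed

text \<open>Genericity forces \<open>X\<close> to have dimension \<open>CARD('n) - q\<close>. The
  smaller \<open>flat x\<close> also meets \<open>F q\<close>, so its dimension cannot be lower.
  This identifies the subspace chosen by \<open>chamber_subspace\<close>.\<close>

lemma poset_Int_sing:
  assumes "q \<in> {0..int CARD('n)}" "X \<in> intersection_poset A" "X \<inter> F q = {x}"
  shows "X = flat x" and "is_vertex q x"
proof -
  have x: "x \<in> X" "x \<in> F q" "F q \<inter> X = {x}"
    using assms(3) by auto
  have dX: "aff_dim X = int CARD('n) - q"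
    using F_generic(2)[OF assms(1,2)] x(3) by simp
  have sub: "flat x \<subseteq> X"
    using flat_subset assms(2) x(1) by blast
  have "int CARD('n) - q \<le> aff_dim (flat x)"
    using F_generic(1)[OF assms(1) flat_in_poset, of x] x(2) mem_flat by blast
  then have "aff_dim (flat x) = aff_dim X"
    using aff_dim_subset[OF sub] dX by simp
  then show "X = flat x" "is_vertex q x"
    using affine_dim_equal[OF flat_affine poset_affine[OF assms(2)] _ sub] mem_flat dX x(2)
    unfolding is_vertex_def by auto
qed

text \<open>A zero value would put \<open>x\<close> in \<open>F (q - 1)\<close>, which a flat of
  dimension \<open>CARD('n) - q\<close> does not meet.\<close>

lemma vertex_form_nonzero:
  assumes "q \<in> {1..int CARD('n)}" "is_vertex q x"
  shows "h q x \<noteq> 0"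
proof
  assume "h q x = 0"
  then have "x \<in> F (q - 1) \<inter> flat x"
    using mem_F_pred_iff[OF assms(1)] assms(2) mem_flat unfolding is_vertex_def by blast
  then have "int CARD('n) - (q - 1) \<le> aff_dim (flat x)"
    using F_generic(1)[OF _ flat_in_poset, of "q - 1" x] assms(1) by auto
  then show False
    using assms(2) unfolding is_vertex_def by simp
qed

text \<open>Part (2) of the standing assumption separates different flats, and a vertex is recovered
  from its flat by intersecting with \<open>F q\<close>.\<close>

lemma vertices_eqI:
  assumes "q \<in> {1..int CARD('n)}" "is_vertex q x" "is_vertex q y" "h q x = h q y"
  shows "x = y"
proof -
  have q: "q \<in> {0..int CARD('n)}"
    using assms(1) by auto
  have x: "flat x \<inter> F q = {x}" "flat y \<inter> F q = {y}"
    using vertex_Int[OF q] assms by auto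
  have "flat x = flat y"
    using poset_Int_form_neq[OF assms(1) flat_in_poset flat_in_poset _ _ _ x] assms(2-4)
    unfolding is_vertex_def by blast
  then have "{x} = {y}"
    using x by metis
  then show ?thesis
    by simp
qed

lemma finite_vertices:
  assumes "q \<in> {0..int CARD('n)}"
  shows "finite {x. is_vertex q x}"
proof (rule finite_imageD)
  show "finite (flat ` {x. is_vertex q x})"
    using finite_poset by (rule finite_subset[rotated]) (use flat_in_poset in blast)
  show "inj_on flat {x. is_vertex q x}"
  proof (rule inj_onI)
    fix x y assume "x \<in> {x. is_vertex q x}" "y \<in> {x. is_vertex q x}" "flat x = flat y"
    then have "{x} = {y}"
      using vertex_Int[OF assms] by (metis mem_Collect_eq)
    then show "x = y"
      by simp
  qed
qed

section \<open>The index of a chamber with respect to the flag\<close>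

lemma ex_flag_index:
  assumes "C \<in> chambers A"
  shows "\<exists>q\<in>{0..int CARD('n)}. C \<in> flag_chambers A F q"
proof -
  have "\<exists>n\<le>CARD('n). C \<inter> F (int n) \<noteq> {}"
    using F_top chamber_nonempty[OF assms] by (intro exI[of _ "CARD('n)"]) auto
  then obtain n where n: "n \<le> CARD('n)" "C \<inter> F (int n) \<noteq> {}"
    and least: "\<And>m. m < n \<Longrightarrow> m \<le> CARD('n) \<Longrightarrow> C \<inter> F (int m) = {}"
    using exists_least_iff[of "\<lambda>n. n \<le> CARD('n) \<and> C \<inter> F (int n) \<noteq> {}"] by blast
  \<comment> \<open>The index is the least \<open>n\<close> for which \<open>C\<close> meets
    \<open>F (int n)\<close>; for \<open>n = 0\<close> the predecessor is the empty
    \<open>F (- 1)\<close>.\<close>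
  have "C \<inter> F (int n - 1) = {}"
  proof (cases n)
    case 0
    then show ?thesis using F_minus1 by simp
  next
    case (Suc m)
    then show ?thesis using least[of m] n(1) by simp
  qed
  then show ?thesis
    using n assms unfolding flag_chambers_def by (intro bexI[of _ "int n"]) auto
qed

lemma flag_index_unique:
  assumes "q \<in> {0..int CARD('n)}" "r \<in> {0..int CARD('n)}"
    and "C \<in> flag_chambers A F q" "C \<in> flag_chambers A F r"
  shows "q = r"
proof -
  have "\<not> q < r" if "q \<in> {0..int CARD('n)}" "r \<in> {0..int CARD('n)}"
    "C \<in> flag_chambers A F q" "C \<in> flag_chambers A F r" for q r
  proof
    assume "q < r"
    then have "F q \<subseteq> F (r - 1)"
      using F_mono[of q "r - 1"] that by auto
    then show False
      using that unfolding flag_chambers_def by blast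
  qed
  then show ?thesis
    using assms by (metis linorder_neqE)
qed

lemma flag_index_eq:
  assumes "q \<in> {0..int CARD('n)}" "C \<in> flag_chambers A F q"
  shows "flag_index A F C = q"
  unfolding flag_index_def using assms flag_index_unique by (intro the_equality) auto

subsection \<open>The minimal vertex of a chamber\<close>

lemma closure_flag_chamber_Int:
  assumes "q \<in> {0..int CARD('n)}" "C \<in> flag_chambers A F q"
  shows "closure (C \<inter> F q) = closure C \<inter> F q"
  using closure_chamber_Int_affine[OF arrangement _ F_affine[OF assms(1)]] assms(2)
  unfolding flag_chambers_def by blast

text \<open>Positivity on \<open>C \<inter> F q\<close>, part (1) of the standing assumption, passes
  to the closure as a weak inequality.\<close>

lemma form_nonneg:
  assumes "q \<in> {1..int CARD('n)}" "C \<in> flag_chambers A F q" "x \<in> closure C \<inter> F q"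
  shows "0 \<le> h q x"
proof -
  have "C \<inter> F q \<subseteq> {x. h q x \<ge> 0}"
    using form_pos[OF assms(1,2)] by (auto intro: less_imp_le)
  moreover have "closed {x. h q x \<ge> 0}"
    using form_continuous[OF assms(1)] by (intro closed_Collect_le) auto
  ultimately have "closure (C \<inter> F q) \<subseteq> {x. h q x \<ge> 0}"
    by (rule closure_minimal)
  then show ?thesis
    using closure_flag_chamber_Int[of q C] assms by auto
qed

text \<open>At a non-vertex the flat meets \<open>F (q - 1)\<close> in a proper nonempty subset of its intersection with
  \<open>F q\<close>, so \<open>h q\<close> is not constant there.\<close>
lemma ex_descent_direction:
  assumes "q \<in> {1..int CARD('n)}" "x \<in> F q" "\<not> is_vertex q x"
  obtains z where "z \<in> flat x \<inter> F q" "h q z \<noteq> h q x"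
proof -
  have q: "q \<in> {0..int CARD('n)}" "q - 1 \<in> {0..int CARD('n)}"
    using assms(1) by auto
  have x: "F q \<inter> flat x \<noteq> {}"
    using assms(2) mem_flat by blast
  have "int CARD('n) - (q - 1) \<le> aff_dim (flat x)"
    using F_generic(1)[OF q(1) flat_in_poset] x assms(2,3) unfolding is_vertex_def by force
  then have y: "F (q - 1) \<inter> flat x \<noteq> {}"
    using F_generic(1)[OF q(2) flat_in_poset] by blast
  then obtain y where y_mem: "y \<in> F (q - 1)" "y \<in> flat x"
    by blast
  then have yF: "y \<in> F q"
    using F_Suc[OF q(1)] by blast
  then have hy: "h q y = 0"
    using mem_F_pred_iff[OF assms(1)] y_mem by blast
  have "aff_dim (F (q - 1) \<inter> flat x) \<noteq> aff_dim (F q \<inter> flat x)"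
    using F_generic(2)[OF q(1) flat_in_poset x] F_generic(2)[OF q(2) flat_in_poset y] by simp
  then have "F (q - 1) \<inter> flat x \<noteq> F q \<inter> flat x"
    by metis
  then obtain z where "z \<in> flat x \<inter> F q" "z \<notin> F (q - 1)"
    using F_Suc[OF q(1)] by blast
  then have "z \<in> flat x \<inter> F q" "h q z \<noteq> h q y"
    using mem_F_pred_iff[OF assms(1)] hy by auto
  \<comment> \<open>\<open>h q\<close> differs at \<open>y\<close> and \<open>z\<close>, so at least
    one of the two values differs from that at \<open>x\<close>.\<close>
  then show thesis
    using that[of y] that[of z] y_mem yF by (cases "h q y = h q x") auto
qed

text \<open>Move inside \<open>flat x \<inter> F q\<close> with \<open>h q\<close> decreasing, as
  far as \<open>closure C\<close> allows. Hyperplanes through \<open>x\<close> are kept, and the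
  stopping point lies on a further one.\<close>

lemma descent_step:
  assumes q: "q \<in> {1..int CARD('n)}" and C: "C \<in> flag_chambers A F q"
    and x: "x \<in> closure C \<inter> F q" and "\<not> is_vertex q x"
  obtains y where "y \<in> closure C \<inter> F q" "h q y < h q x"
    and "{H \<in> A. x \<in> H} \<subset> {H \<in> A. y \<in> H}"
proof -
  have q0: "q \<in> {0..int CARD('n)}"
    using q by auto
  have chC: "C \<in> chambers A"
    using C unfolding flag_chambers_def by blast
  obtain z where z: "z \<in> flat x \<inter> F q" "h q z \<noteq> h q x"
    using ex_descent_direction[OF q _ assms(4)] x by blast
  \<comment> \<open>The scaling makes \<open>h q\<close> decrease at unit rate, whichever of
    \<open>x\<close> and \<open>z\<close> has the larger value.\<close>
  define u where "u = (1 / (h q x - h q z)) *\<^sub>R (z - x)"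
  have line: "x + t *\<^sub>R u \<in> flat x \<inter> F q" for t
    using affine_line_mem[OF affine_Int[OF flat_affine F_affine[OF q0]], of x x z] x z mem_flat
    unfolding u_def by auto
  have h_line: "h q (x + t *\<^sub>R u) = h q x - t" for t
  proof -
    have "h q (x + t *\<^sub>R u) = h q x + t / (h q x - h q z) * (h q z - h q x)"
      unfolding u_def using form_line[OF q, of x "t / (h q x - h q z)" z] by simp
    also have "\<dots> = h q x - t"
      using z(2) by (simp add: field_simps)
    finally show ?thesis .
  qed
  \<comment> \<open>The bound \<open>h q x\<close> excludes nothing because \<open>h q\<close> is
    nonnegative on \<open>closure C \<inter> F q\<close>; it makes \<open>T\<close> compact.\<close>
  define T where "T = {t \<in> {0..h q x}. x + t *\<^sub>R u \<in> closure C}"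
  have mem_T: "t \<in> T \<longleftrightarrow> t \<ge> 0 \<and> x + t *\<^sub>R u \<in> closure C" for t
    using form_nonneg[OF q C, of "x + t *\<^sub>R u"] line[of t] h_line[of t] unfolding T_def by auto
  have "T = {0..h q x} \<inter> (\<lambda>t. x + t *\<^sub>R u) -` closure C"
    unfolding T_def by auto
  moreover have "closed ((\<lambda>t. x + t *\<^sub>R u) -` closure C)"
    by (intro closed_vimage continuous_intros) auto
  ultimately have "compact T"
    by (simp add: compact_Int_closed)
  moreover have "0 \<in> T"
    using mem_T x by simp
  ultimately obtain s where s: "s \<in> T" "\<And>t. t \<in> T \<Longrightarrow> t \<le> s"
    using compact_attains_sup[of T] by blast
  define y where "y = x + s *\<^sub>R u"
  \<comment> \<open>If \<open>u\<close> were parallel to all hyperplanes through \<open>y\<close>,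
    the path could be prolonged beyond the maximal \<open>s\<close>.\<close>
  have "\<exists>H\<in>A. y \<in> H \<and> y + u \<notin> H"
  proof (rule ccontr)
    assume "\<not> ?thesis"
    then obtain e where "e > 0" "y + e *\<^sub>R u \<in> closure C"
      using closure_chamber_extend[OF arrangement chC, of y u] mem_T s(1) y_def by blast
    then have "s + e \<in> T"
      using mem_T s(1) unfolding y_def by (simp add: algebra_simps)
    then show False
      using s(2) \<open>e > 0\<close> by fastforce
  qed
  then obtain H where H: "H \<in> A" "y \<in> H" "y + u \<notin> H"
    by blast
  have "x \<notin> H"
  proof
    assume "x \<in> H"
    then have "flat x \<subseteq> H"
      using H(1) unfolding flat_def by blast
    then show False
      using line[of "s + 1"] H(3) unfolding y_def by (auto simp: algebra_simps)
  qed
  moreover have "{H \<in> A. x \<in> H} \<subseteq> {H \<in> A. y \<in> H}"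
    using line[of s] unfolding y_def flat_def by blast
  ultimately have sub: "{H \<in> A. x \<in> H} \<subset> {H \<in> A. y \<in> H}"
    using H by blast
  then have "s \<noteq> 0"
    unfolding y_def by auto
  then have "h q y < h q x"
    using s(1) mem_T h_line[of s] unfolding y_def by auto
  moreover have "y \<in> closure C \<inter> F q"
    using s(1) mem_T line[of s] unfolding y_def by blast
  ultimately show thesis
    using that sub by blast
qed

text \<open>Each descent step puts the point on more hyperplanes, so the number of hyperplanes
  missing it decreases until a vertex is reached.\<close>

lemma ex_lower_vertex:
  assumes "q \<in> {1..int CARD('n)}" "C \<in> flag_chambers A F q" "x \<in> closure C \<inter> F q"
  shows "\<exists>y\<in>closure C. is_vertex q y \<and> h q y \<le> h q x"
  using assms(3)
proof (induction "card {H \<in> A. x \<notin> H}" arbitrary: x rule: less_induct)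
  case less
  show ?case
  proof (cases "is_vertex q x")
    case True
    then show ?thesis
      using less.prems by blast
  next
    case False
    obtain y where y: "y \<in> closure C \<inter> F q" "h q y < h q x"
      "{H \<in> A. x \<in> H} \<subset> {H \<in> A. y \<in> H}"
      using descent_step[OF assms(1,2) less.prems False] by blast
    have "finite A"
      using arrangement unfolding arrangement_def by blast
    then have "card {H \<in> A. y \<notin> H} < card {H \<in> A. x \<notin> H}"
      using y(3) by (intro psubset_card_mono) auto
    then show ?thesis
      using less.hyps y by force
  qed
qed

abbreviation is_min :: "int \<Rightarrow> (real^'n) set \<Rightarrow> real^'n \<Rightarrow> bool" where
  "is_min q C \<equiv> is_arg_min (h q) (\<lambda>x. x \<in> closure C \<inter> F q)"

lemma is_min_vertex:
  assumes "q \<in> {1..int CARD('n)}" "C \<in> flag_chambers A F q" "is_min q C x"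
  shows "is_vertex q x"
proof (rule ccontr)
  have x: "x \<in> closure C \<inter> F q" "\<And>y. y \<in> closure C \<inter> F q \<Longrightarrow> h q x \<le> h q y"
    using assms(3) unfolding is_arg_min_linorder by auto
  assume "\<not> is_vertex q x"
  then obtain y where "y \<in> closure C \<inter> F q" "h q y < h q x"
    using descent_step[OF assms(1,2) x(1)] by metis
  then show False
    using x(2)[of y] by simp
qed

text \<open>The polyhedron may be unbounded, so the minimum is taken over its finitely many
  vertices; no point lies below all of them. Uniqueness holds because distinct vertices have
  distinct values of \<open>h q\<close>.\<close>

lemma ex1_is_min:
  assumes "q \<in> {1..int CARD('n)}" "C \<in> flag_chambers A F q"
  shows "\<exists>!x. is_min q C x"
proof -
  have q0: "q \<in> {0..int CARD('n)}"
    using assms(1) by auto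
  let ?V = "{x \<in> closure C. is_vertex q x}"
  have "finite ?V"
    using finite_vertices[OF q0] by (rule finite_subset[rotated]) auto
  obtain d where "d \<in> closure C \<inter> F q"
    using assms(2) closure_subset unfolding flag_chambers_def by blast
  then have "?V \<noteq> {}"
    using ex_lower_vertex[OF assms] by blast
  then obtain x where x: "x \<in> ?V" "\<And>y. y \<in> ?V \<Longrightarrow> h q x \<le> h q y"
    using ex_is_arg_min_if_finite[OF \<open>finite ?V\<close>, of "h q"]
    unfolding is_arg_min_linorder by blast
  have "is_min q C x"
    unfolding is_arg_min_linorder
  proof (intro conjI allI impI)
    show "x \<in> closure C \<inter> F q"
      using x(1) unfolding is_vertex_def by blast
    fix y assume "y \<in> closure C \<inter> F q"
    then obtain z where "z \<in> ?V" "h q z \<le> h q y"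
      using ex_lower_vertex[OF assms] by blast
    then show "h q x \<le> h q y"
      using x(2)[of z] by simp
  qed
  moreover have "y = x" if "is_min q C y" for y
  proof (rule vertices_eqI[OF assms(1)])
    show "is_vertex q y" "is_vertex q x"
      by (rule is_min_vertex[OF assms that], rule is_min_vertex[OF assms \<open>is_min q C x\<close>])
    show "h q y = h q x"
      using that \<open>is_min q C x\<close> unfolding is_arg_min_linorder by (intro antisym) auto
  qed
  ultimately show ?thesis
    by (rule ex1I)
qed

lemma is_min_min_vertex:
  assumes "q \<in> {1..int CARD('n)}" "C \<in> flag_chambers A F q"
  shows "is_min q C (min_vertex F h q C)"
  unfolding min_vertex_def by (rule theI'[OF ex1_is_min[OF assms]])

lemma min_vertex_eq:
  assumes "q \<in> {1..int CARD('n)}" "C \<in> flag_chambers A F q" "is_min q C x"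
  shows "min_vertex F h q C = x"
  using ex1_is_min[OF assms(1,2)] is_min_min_vertex[OF assms(1,2)] assms(3) by blast

lemma chamber_subspace_eq_flat:
  assumes "q \<in> {1..int CARD('n)}" "C \<in> flag_chambers A F q"
  shows "chamber_subspace A F h C = flat (min_vertex F h q C)"
proof -
  let ?p = "min_vertex F h q C"
  have q0: "q \<in> {0..int CARD('n)}" "q \<noteq> 0"
    using assms(1) by auto
  have "flat ?p \<inter> F q = {?p}"
    by (intro vertex_Int is_min_vertex[OF assms is_min_min_vertex[OF assms]] q0)
  then have "(THE X. X \<in> intersection_poset A \<and> X \<inter> F q = {?p}) = flat ?p"
    using flat_in_poset poset_Int_sing(1)[OF q0(1)] by (intro the_equality) auto
  then show ?thesis
    unfolding chamber_subspace_def flag_index_eq[OF q0(1) assms(2)] using q0 by simp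
qed

lemma chamber_subspace_zero:
  assumes "C \<in> flag_chambers A F 0"
  shows "chamber_subspace A F h C = UNIV"
  unfolding chamber_subspace_def using flag_index_eq[OF _ assms] by simp

end

text \<open>The intersection poset shrinks, so the conditions on flats are inherited. Only
  positivity of \<open>h q\<close> needs an argument, as chambers of \<open>B\<close> are larger: it
  holds off the hyperplanes of \<open>A\<close>, and such points are dense.\<close>

lemma flagged_arrangement_subset:
  fixes A :: "(real^'n) set set"
  assumes "flagged_arrangement A F h" "B \<subseteq> A"
  shows "flagged_arrangement B F h"
proof -
  interpret flagged_arrangement A F h by fact
  have arrB: "arrangement B"
    using arrangement_subset[OF arrangement assms(2)] .
  have sub: "intersection_poset B \<subseteq> intersection_poset A"
    using intersection_poset_mono[OF assms(2)] .
  have pos: "D \<inter> F q \<subseteq> {x. (\<forall>i\<in>{q+1..int CARD('n)}. h i x = 0) \<and> h q x > 0}"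
    if q: "q \<in> {1..int CARD('n)}" and D: "D \<in> flag_chambers B F q" for q D
  proof
    fix d assume d: "d \<in> D \<inter> F q"
    have q0: "q \<in> {0..int CARD('n)}"
      using q by auto
    have D': "D \<in> chambers B" "D \<inter> F (q - 1) = {}"
      using D unfolding flag_chambers_def by auto
    have pos: "h q x > 0"
      if x: "x \<in> D \<inter> F q" "x \<notin> \<Union>A" for x
    proof -
      obtain C where C: "C \<in> chambers A" "x \<in> C"
        using ex_chamber[OF x(2)] by blast
      \<comment> \<open>Inside \<open>D\<close>, the chamber \<open>C\<close> also misses
        \<open>F (q - 1)\<close>, so it has index \<open>q\<close> and part (1) for \<open>A\<close>
        applies.\<close>
      then have "C \<subseteq> D"
        using chamber_subset_chamber[OF assms(2) _ D'(1)] x by blast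
      then have "C \<in> flag_chambers A F q"
        using C x D' unfolding flag_chambers_def by blast
      then show ?thesis
        using form_pos[OF q _ C(2)] x by blast
    qed
    have ex_near: "\<exists>x\<in>F q \<inter> U. x \<in> D \<and> x \<notin> \<Union>A" if "open U" "d \<in> U" for U
      using ex_point_off_hyperplanes[OF arrangement F_affine[OF q0], of d "U \<inter> D"] d that
        chamber_open[OF arrB D'(1)] F_not_subset_hyperplane[OF q0] by blast
    have zero: "\<forall>i\<in>{q+1..int CARD('n)}. h i d = 0"
      using form_zero[OF q] d by blast
    \<comment> \<open>Zero is excluded as \<open>D\<close> misses \<open>F (q - 1)\<close>; a
      negative value would persist at nearby points off the hyperplanes of \<open>A\<close>.\<close>
    have "h q d \<noteq> 0"
      using mem_F_pred_iff[OF q] d D' by blast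
    moreover have "\<not> h q d < 0"
    proof
      assume "h q d < 0"
      moreover have "open {x. h q x < 0}"
        using form_continuous[OF q] by (intro open_Collect_less) auto
      ultimately obtain x where "x \<in> F q \<inter> {x. h q x < 0}" "x \<in> D" "x \<notin> \<Union>A"
        using ex_near[of "{x. h q x < 0}"] by blast
      then show False
        using pos[of x] by auto
    qed
    ultimately show "d \<in> {x. (\<forall>i\<in>{q+1..int CARD('n)}. h i x = 0) \<and> h q x > 0}"
      using zero by auto
  qed
  have "standing_assumption B F h"
    unfolding standing_assumption_def
  proof (intro ballI conjI impI allI pos)
    fix q X X' x x'
    assume "q \<in> {1..int CARD('n)}" "X \<in> intersection_poset B" "X' \<in> intersection_poset B"
      and "X \<noteq> X' \<and> aff_dim X = int CARD('n) - q \<and> aff_dim X' = int CARD('n) - q"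
      and "X \<inter> F q = {x} \<and> X' \<inter> F q = {x'}"
    then show "h q x \<noteq> h q x'"
      using poset_Int_form_neq[of q X X' x x'] sub by blast
  qed
  moreover have "generic_flag B F"
    using flag sub unfolding generic_flag_def by blast
  ultimately show ?thesis
    using arrB forms by (intro flagged_arrangement.intro)
qed

subsection \<open>Chambers of a subarrangement\<close>

context flagged_arrangement
begin

text \<open>All hyperplanes of \<open>A\<close> through the minimal vertex of \<open>C\<close> are
  in \<open>B\<close>, so \<open>C\<close> and \<open>D\<close> agree near it; a local minimum of an
  affine form on a convex set is global.\<close>

lemma min_of_subarrangement:
  assumes B: "B = {H \<in> A. v \<in> direction H}"
    and D: "D \<in> chambers B"
    and q: "q \<in> {1..int CARD('n)}" and C: "C \<in> flag_chambers A F q" "C \<subseteq> D"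
    and v: "v \<in> direction (chamber_subspace A F h C)"
  defines "x \<equiv> min_vertex F h q C"
  obtains e where "D \<in> flag_chambers B F q" "is_min q D x" "e > 0" "ball x e \<inter> D \<subseteq> C"
proof -
  have subB: "B \<subseteq> A" and q0: "q \<in> {0..int CARD('n)}"
    using B q by auto
  have arrB: "arrangement B"
    using arrangement_subset[OF arrangement subB] .
  have chC: "C \<in> chambers A" "C \<inter> F q \<noteq> {}"
    using C unfolding flag_chambers_def by auto
  have min: "is_min q C x"
    unfolding x_def by (rule is_min_min_vertex[OF q C(1)])
  then have x: "x \<in> closure C" "x \<in> F q" and vx: "is_vertex q x"
    using is_min_vertex[OF q C(1)] unfolding is_arg_min_def by auto
  have "H \<in> B" if "H \<in> A" "x \<in> H" for H
    using v that unfolding chamber_subspace_eq_flat[OF q C(1)] mem_direction_flat_iff B x_def by blast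
  then obtain e where e: "e > 0" "ball x e \<inter> D \<subseteq> C"
    using chambers_agree_near[OF arrangement subB chC(1) D C(2) x(1)] by blast
  have cl: "ball x e \<inter> closure D \<subseteq> closure C"
    using open_Int_closure_subset[of "ball x e" D] closure_mono[OF e(2)] by auto
  have convD: "convex (closure D)"
    using chamber_convex[OF arrB D] by (rule convex_closure)
  have le: "h q x \<le> h q y" if y: "y \<in> closure D \<inter> F q" for y
  proof (rule ccontr)
    \<comment> \<open>A lower \<open>y\<close> would make the points of the segment from
      \<open>x\<close> towards \<open>y\<close> lower than \<open>x\<close>, but those near
      \<open>x\<close> lie in \<open>closure C\<close>.\<close>
    assume "\<not> h q x \<le> h q y"
    then have lt: "h q y < h q x"
      by simp
    have lim: "((\<lambda>t. x + t *\<^sub>R (y - x)) \<longlongrightarrow> x + 0 *\<^sub>R (y - x)) (at_right 0)"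
      by (intro tendsto_intros)
    have "\<forall>\<^sub>F t in at_right 0. x + t *\<^sub>R (y - x) \<in> ball x e"
      using topological_tendstoD[OF lim open_ball[of x e]] e(1) by simp
    moreover have "\<forall>\<^sub>F t in at_right 0. t \<in> {0<..<1::real}"
      by (rule eventually_at_right_real) simp
    ultimately have "\<forall>\<^sub>F t in at_right 0. t \<in> {0<..<1} \<and> x + t *\<^sub>R (y - x) \<in> ball x e"
      by eventually_elim simp
    then obtain t :: real where t: "t \<in> {0<..<1}" "x + t *\<^sub>R (y - x) \<in> ball x e"
      using eventually_happens'[OF trivial_limit_at_right_real] by blast
    have "(1 - t) *\<^sub>R x + t *\<^sub>R y \<in> closure D"
      using convexD_alt[OF convD, of x y t] x(1) y t(1) closure_mono[OF C(2)] by auto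
    then have "x + t *\<^sub>R (y - x) \<in> closure D"
      by (simp add: algebra_simps)
    then have "x + t *\<^sub>R (y - x) \<in> closure C \<inter> F q"
      using cl t(2) affine_line_mem[OF F_affine[OF q0] x(2)] y by blast
    moreover have "h q (x + t *\<^sub>R (y - x)) < h q x"
      using form_line[OF q] lt t(1) by (simp add: mult_pos_neg)
    ultimately show False
      using min unfolding is_arg_min_def by blast
  qed
  then have minD: "is_min q D x"
    unfolding is_arg_min_linorder using x closure_mono[OF C(2)] by blast
  \<comment> \<open>\<open>h q\<close> vanishes on \<open>F (q - 1)\<close>, so a positive minimum
    keeps \<open>D\<close> away from it.\<close>
  have "h q x > 0"
    using form_nonneg[OF q C(1)] vertex_form_nonzero[OF q vx] x by force
  then have "D \<inter> F (q - 1) = {}"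
    using le closure_subset[of D] F_Suc[OF q0] mem_F_pred_iff[OF q] by fastforce
  then have "D \<in> flag_chambers B F q"
    using D chC(2) C(2) unfolding flag_chambers_def by blast
  then show thesis
    using that minD e by blast
qed

text \<open>Every candidate has the index \<open>q\<close> of \<open>D\<close>. It contains the
  point of \<open>F 0\<close> if \<open>q = 0\<close>, and otherwise all of \<open>D\<close> near
  the minimal vertex of \<open>D\<close>, so two candidates share a point.\<close>

lemma chamber_of_subarrangement_unique:
  assumes B: "B = {H \<in> A. v \<in> direction H}"
    and D: "D \<in> chambers B"
    and C: "C \<in> chambers A" "C \<subseteq> D" "v \<in> direction (chamber_subspace A F h C)"
    and C': "C' \<in> chambers A" "C' \<subseteq> D" "v \<in> direction (chamber_subspace A F h C')"
  shows "C = C'"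
proof -
  have subB: "B \<subseteq> A"
    using B by blast
  interpret B: flagged_arrangement B F h
    using flagged_arrangement_subset subB flagged_arrangement_axioms by blast
  obtain q where q: "q \<in> {0..int CARD('n)}" "D \<in> flag_chambers B F q"
    using B.ex_flag_index[OF D] by blast
  have fc: "K \<in> flag_chambers A F q"
    if K: "K \<in> chambers A" "K \<subseteq> D" "v \<in> direction (chamber_subspace A F h K)" for K
  proof -
    obtain r where r: "r \<in> {0..int CARD('n)}" "K \<in> flag_chambers A F r"
      using ex_flag_index[OF K(1)] by blast
    have "D \<in> flag_chambers B F r"
    proof (cases "r = 0")
      case True
      then show ?thesis
        using r K D F_minus1 unfolding flag_chambers_def by auto
    next
      case False
      then have "r \<in> {1..int CARD('n)}"
        using r(1) by auto
      then show ?thesis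
        using min_of_subarrangement[OF B D _ r(2) K(2,3)] by blast
    qed
    then show ?thesis
      using B.flag_index_unique[OF q(1) r(1) q(2)] r(2) by blast
  qed
  show ?thesis
  proof (cases "q = 0")
    case True
    obtain c where "F 0 = {c}"
      using F_zero_sing by blast
    then have "c \<in> C" "c \<in> C'"
      using fc[OF C] fc[OF C'] True unfolding flag_chambers_def by auto
    then show ?thesis
      using chamber_eqI C(1) C'(1) by blast
  next
    case False
    then have q1: "q \<in> {1..int CARD('n)}"
      using q(1) by auto
    define x where "x = min_vertex F h q D"
    have near: "x \<in> closure D \<and> (\<exists>e>0. ball x e \<inter> D \<subseteq> K)"
      if K: "K \<in> chambers A" "K \<subseteq> D" "v \<in> direction (chamber_subspace A F h K)" for K
    proof -
      obtain e where e: "is_min q D (min_vertex F h q K)" "e > 0"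
        "ball (min_vertex F h q K) e \<inter> D \<subseteq> K"
        using min_of_subarrangement[OF B D q1 fc[OF K] K(2,3)] by blast
      then have "min_vertex F h q K = x"
        unfolding x_def using B.min_vertex_eq[OF q1 q(2)] by metis
      then show ?thesis
        using e unfolding is_arg_min_def by auto
    qed
    obtain e e' where e: "x \<in> closure D" "e > 0" "ball x e \<inter> D \<subseteq> C"
      "e' > 0" "ball x e' \<inter> D \<subseteq> C'"
      using near[OF C] near[OF C'] by blast
    then obtain y where "y \<in> D" "dist y x < min e e'"
      unfolding closure_approachable by (metis min_less_iff_conj)
    then have "y \<in> ball x e \<inter> D" "y \<in> ball x e' \<inter> D"
      by (auto simp: dist_commute)
    then show ?thesis
      using chamber_eqI C(1) C'(1) e by blast
  qed
qed

text \<open>For \<open>q = 0\<close> take the chamber containing the point of \<open>F 0\<close>;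
  otherwise the one that fills \<open>D\<close> near its minimal vertex.\<close>

lemma ex_chamber_of_subarrangement:
  assumes B: "B = {H \<in> A. v \<in> direction H}"
    and D: "D \<in> chambers B"
  shows "\<exists>C\<in>chambers A. C \<subseteq> D \<and> v \<in> direction (chamber_subspace A F h C)"
proof -
  have subB: "B \<subseteq> A"
    using B by blast
  interpret B: flagged_arrangement B F h
    using flagged_arrangement_subset subB flagged_arrangement_axioms by blast
  obtain q where q: "q \<in> {0..int CARD('n)}" "D \<in> flag_chambers B F q"
    using B.ex_flag_index[OF D] by blast
  show ?thesis
  proof (cases "q = 0")
    case True
    obtain c where c: "F 0 = {c}"
      using F_zero_sing by blast
    then have "c \<notin> \<Union>A"
      using F_not_subset_hyperplane[of 0] by auto
    then obtain C where C: "C \<in> chambers A" "c \<in> C"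
      using ex_chamber by blast
    then have "C \<in> flag_chambers A F 0"
      using c F_minus1 unfolding flag_chambers_def by auto
    then have "chamber_subspace A F h C = UNIV"
      by (rule chamber_subspace_zero)
    moreover have "c \<in> D"
      using q(2) True c unfolding flag_chambers_def by auto
    then have "C \<subseteq> D"
      by (rule chamber_subset_chamber[OF subB C(1) D C(2)])
    ultimately show ?thesis
      using C(1) by (intro bexI[of _ C]) simp_all
  next
    case False
    then have q1: "q \<in> {1..int CARD('n)}"
      using q(1) by auto
    define x where "x = min_vertex F h q D"
    have min: "B.is_min q D x"
      unfolding x_def by (rule B.is_min_min_vertex[OF q1 q(2)])
    then have x: "x \<in> closure D \<inter> F q"
      unfolding is_arg_min_def by blast
    \<comment> \<open>\<open>B.flat x\<close> already cuts out \<open>x\<close> on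
      \<open>F q\<close>, so genericity for \<open>A\<close> leaves no room for a smaller flat.
      Hence \<open>v\<close> is parallel to every hyperplane of \<open>A\<close> through
      \<open>x\<close>.\<close>
    have "B.flat x \<inter> F q = {x}"
      by (intro B.vertex_Int B.is_min_vertex[OF q1 q(2) min] q)
    moreover have "B.flat x \<in> intersection_poset A"
      by (rule subsetD[OF intersection_poset_mono[OF subB] B.flat_in_poset])
    ultimately have flat: "B.flat x = flat x"
      by (intro poset_Int_sing(1)[OF q(1)])
    have "v \<in> direction (B.flat x)"
      unfolding B.mem_direction_flat_iff using B by blast
    then have v: "v \<in> direction (flat x)"
      using flat by simp
    then have thru: "H \<in> B" if "H \<in> A" "x \<in> H" for H
      unfolding mem_direction_flat_iff B using that by blast
    obtain e where e: "e > 0" "\<And>H. H \<in> A \<Longrightarrow> H \<inter> ball x e \<noteq> {} \<Longrightarrow> x \<in> H"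
      using no_new_hyperplane_near[OF arrangement] by blast
    have off: "ball x e \<inter> D \<inter> \<Union>A = {}"
      using e(2) thru chamber_disjoint_Union[OF D] by blast
    \<comment> \<open>The nearby point is taken in \<open>F q\<close> so that its chamber has index
      \<open>q\<close>.\<close>
    have "x \<in> closure (D \<inter> F q)"
      using B.closure_flag_chamber_Int[OF q] x by blast
    then obtain d where d: "d \<in> D" "d \<in> F q" "d \<in> ball x e"
      using e(1) unfolding closure_approachable by (auto simp: dist_commute)
    then obtain C where C: "C \<in> chambers A" "d \<in> C"
      using off ex_chamber by blast
    have CD: "C \<subseteq> D"
      using chamber_subset_chamber[OF subB C(1) D C(2) d(1)] .
    have fcC: "C \<in> flag_chambers A F q"
      using C d CD q(2) unfolding flag_chambers_def by blast
    have "connected (ball x e \<inter> D)"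
      by (intro convex_connected convex_Int convex_ball chamber_convex[OF B.arrangement D])
    then have "ball x e \<inter> D \<subseteq> C"
      using connected_subset_chamber[OF C(1) _ off C(2)] d by blast
    then have "x \<in> closure C"
      using open_Int_closure_subset[of "ball x e" D] closure_mono[of "ball x e \<inter> D" C] x
        centre_in_ball[of x e] e(1)
      by blast
    then have "is_min q C x"
      using min x closure_mono[OF CD] unfolding is_arg_min_def by blast
    then have "chamber_subspace A F h C = flat x"
      by (simp add: chamber_subspace_eq_flat[OF q1 fcC] min_vertex_eq[OF q1 fcC])
    then show ?thesis
      using C(1) CD v by (intro bexI[of _ C]) simp_all
  qed
qed

end

section \<open>Decomposition of the complexified complement\<close>

theorem theorem3p10:
  fixes A :: "(real^'n) set set"
    and F :: "int \<Rightarrow> (real^'n) set"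
    and h :: "int \<Rightarrow> real^'n \<Rightarrow> real"
    and p :: "(real^'n) set \<Rightarrow> real^'n"
  assumes "arrangement A"
    and "generic_flag A F"
    and "flag_forms F h"
    and "standing_assumption A F h"
    and "base_points A F p"
  shows "complexified_complement A = (\<Union>C\<in>chambers A. chamber_stratum A F h p C)
    \<and> disjoint_family_on (chamber_stratum A F h p) (chambers A)"
proof -
  interpret flagged_arrangement A F h
    using assms(1-4) by unfold_locales
  let ?B = "\<lambda>v. {H \<in> A. v \<in> direction H}"
  let ?z = "\<lambda>x v. (\<chi> i. complex_of_real (x $ i) + \<i> * complex_of_real (v $ i)) :: complex^'n"
  have base: "p C \<in> C" if "C \<in> chambers A" for C
    using ex_flag_index[OF that] assms(5) unfolding base_points_def by blast
  have chamber_of: "\<exists>D\<in>chambers (?B v). C \<subseteq> D" if "C \<in> chambers A" for C v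
  proof -
    have "p C \<notin> \<Union>(?B v)"
      using base[OF that] chamber_disjoint_Union[OF that] by blast
    then obtain D where "D \<in> chambers (?B v)" "p C \<in> D"
      using ex_chamber by blast
    then show ?thesis
      using chamber_subset_chamber[of "?B v" A C D "p C"] that base[OF that] by blast
  qed
  \<comment> \<open>The condition on \<open>Sep\<close> says that the segment from
    \<open>p C\<close> to \<open>x\<close> avoids the hyperplanes parallel to \<open>v\<close>, that
    is, stays in the chamber \<open>D\<close> of \<open>?B v\<close>.\<close>
  have stratum_iff: "?z x v \<in> chamber_stratum A F h p C \<longleftrightarrow>
      x \<in> D \<and> v \<in> direction (chamber_subspace A F h C)"
    if C: "C \<in> chambers A" and D: "D \<in> chambers (?B v)" "C \<subseteq> D" for x v C D
  proof -
    have "arrangement (?B v)"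
      by (rule arrangement_subset[OF assms(1)]) auto
    moreover have "p C \<in> D"
      using base[OF C] D(2) by blast
    ultimately have "x \<in> D \<longleftrightarrow> closed_segment (p C) x \<inter> \<Union>(?B v) = {}"
      using mem_chamber_iff_segment[of "?B v" D "p C" x] D(1) by simp
    also have "\<dots> \<longleftrightarrow> (\<forall>H\<in>Sep A (p C) x. v \<notin> direction H)"
      unfolding Sep_def by blast
    finally show ?thesis
      unfolding chamber_stratum_def mem_Collect_eq real_imaginary_parts_eq_iff by blast
  qed
  have ex_stratum: "?z x v \<in> complexified_complement A \<longleftrightarrow>
      (\<exists>C\<in>chambers A. ?z x v \<in> chamber_stratum A F h p C)" for x v
  proof
    assume "?z x v \<in> complexified_complement A"
    then have "x \<notin> \<Union>(?B v)"
      unfolding mem_complexified_complement_iff[OF assms(1)] .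
    then obtain D where D: "D \<in> chambers (?B v)" "x \<in> D"
      using ex_chamber by blast
    then obtain C where C: "C \<in> chambers A" "C \<subseteq> D" "v \<in> direction (chamber_subspace A F h C)"
      using ex_chamber_of_subarrangement[OF refl D(1)] by blast
    then show "\<exists>C\<in>chambers A. ?z x v \<in> chamber_stratum A F h p C"
      using stratum_iff[OF C(1) D(1) C(2)] D(2) by blast
  next
    assume "\<exists>C\<in>chambers A. ?z x v \<in> chamber_stratum A F h p C"
    then obtain C where C: "C \<in> chambers A" "?z x v \<in> chamber_stratum A F h p C"
      by blast
    then obtain D where D: "D \<in> chambers (?B v)" "C \<subseteq> D"
      using chamber_of by blast
    then have "x \<in> D"
      using stratum_iff[OF C(1) D] C(2) by blast
    then show "?z x v \<in> complexified_complement A"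
      unfolding mem_complexified_complement_iff[OF assms(1)]
      using chamber_disjoint_Union[OF D(1)] by blast
  qed
  have unique: "C = C'"
    if C: "C \<in> chambers A" "?z x v \<in> chamber_stratum A F h p C"
      and C': "C' \<in> chambers A" "?z x v \<in> chamber_stratum A F h p C'" for x v C C'
  proof -
    obtain D D' where D: "D \<in> chambers (?B v)" "C \<subseteq> D" and D': "D' \<in> chambers (?B v)" "C' \<subseteq> D'"
      using chamber_of C(1) C'(1) by meson
    have "x \<in> D" "x \<in> D'" "v \<in> direction (chamber_subspace A F h C)"
      "v \<in> direction (chamber_subspace A F h C')"
      using stratum_iff[OF C(1) D] stratum_iff[OF C'(1) D'] C(2) C'(2) by blast+
    \<comment> \<open>Both \<open>D\<close> and \<open>D'\<close> contain \<open>x\<close>, so they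
      are the same chamber, which has a single admissible \<open>C\<close>.\<close>
    then show ?thesis
      using chamber_of_subarrangement_unique[OF refl D(1) C(1) D(2) _ C'(1)]
        chamber_eqI[OF D(1) D'(1), of x] D'(2) by blast
  qed
  have "complexified_complement A = (\<Union>C\<in>chambers A. chamber_stratum A F h p C)"
  proof (rule set_eqI)
    fix z :: "complex^'n"
    obtain x v where "z = ?z x v"
      using ex_real_imaginary_parts by blast
    then show "z \<in> complexified_complement A \<longleftrightarrow>
        z \<in> (\<Union>C\<in>chambers A. chamber_stratum A F h p C)"
      using ex_stratum by blast
  qed
  moreover have "disjoint_family_on (chamber_stratum A F h p) (chambers A)"
    unfolding disjoint_family_on_def
  proof (intro ballI impI equals0I)
    fix C C' z
    assume C: "C \<in> chambers A" "C' \<in> chambers A" "C \<noteq> C'"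
      and z: "z \<in> chamber_stratum A F h p C \<inter> chamber_stratum A F h p C'"
    obtain x v where "z = ?z x v"
      using ex_real_imaginary_parts by blast
    then show False
      using unique C z by blast
  qed
  ultimately show ?thesis
    by blast
qed

end
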